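(* Let $\Gamma$ be a distance-regular graph with diameter $D \geq 2$. Assume that the $q$-distance matrix $\mathbb{D}_q$ of $\Gamma$ has exactly one positive eigenvalue for some real $q$ with $-1 < q < 1$, $q\neq 0$. Then $c_2 = 1$ and $0 < q < 1$.
   Context: A connected graph $\Gamma$ of diameter $D$ is distance-regular if for all vertices $x,y$ at distance $h$ the number $p^h_{ij}$ of vertices $z$ with $d(x,z)=i$, $d(y,z)=j$ depends only on $h,i,j$; $c_2=p^2_{1,1}$ is the number of common neighbours of two vertices at distance $2$. For real $q\ne0$, $\mathbb{D}_q$ has zero diagonal and $(\mathbb{D}_q)_{xy} = 1 + \frac{1}{q} + \cdots + \frac{1}{q^{d(x,y)-1}}$ for $x \neq y$. *)

theory Defs
  imports "HOL-Analysis.Analysis" "Graph_Theory.Graph_Theory"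
begin

text \<open>
  A finite simple undirected graph is a \<open>pair_graph\<close>: finite, loopless, with a symmetric set of
  arcs.
\<close>

definition graph_dist :: "'a pair_pre_digraph \<Rightarrow> 'a \<Rightarrow> 'a \<Rightarrow> nat" where
  "graph_dist G x y = Inf {length p | p. pre_digraph.awalk (with_proj G) x p y}"

definition graph_diameter :: "'a pair_pre_digraph \<Rightarrow> nat" where
  "graph_diameter G = Max {graph_dist G x y | x y. x \<in> pverts G \<and> y \<in> pverts G}"

definition sphere_inter :: "'a pair_pre_digraph \<Rightarrow> nat \<Rightarrow> nat \<Rightarrow> 'a \<Rightarrow> 'a \<Rightarrow> 'a set" where
  "sphere_inter G i j x y = {z \<in> pverts G. graph_dist G x z = i \<and> graph_dist G y z = j}"

text \<open>
  The plain name \<open>connected\<close> is also a topological notion, hence the qualification.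
\<close>

definition distance_regular :: "'a pair_pre_digraph \<Rightarrow> bool" where
  "distance_regular G \<longleftrightarrow>
     pair_graph G \<and> Digraph_Component.connected (with_proj G) \<and>
     (\<forall>h i j. \<forall>x\<in>pverts G. \<forall>y\<in>pverts G. \<forall>x'\<in>pverts G. \<forall>y'\<in>pverts G.
        graph_dist G x y = h \<and> graph_dist G x' y' = h \<longrightarrow>
        card (sphere_inter G i j x y) = card (sphere_inter G i j x' y'))"

text \<open>
  \<open>intersection_number G h i j\<close> is $p^h_{ij}$. It is well defined when \<open>G\<close> is distance-regular and
  \<open>h\<close> is at most the diameter.
\<close>

definition intersection_number :: "'a pair_pre_digraph \<Rightarrow> nat \<Rightarrow> nat \<Rightarrow> nat \<Rightarrow> nat" where
  "intersection_number G h i j =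
     (THE n. \<forall>x\<in>pverts G. \<forall>y\<in>pverts G. graph_dist G x y = h \<longrightarrow> card (sphere_inter G i j x y) = n)"

definition c2 :: "'a pair_pre_digraph \<Rightarrow> nat" where
  "c2 G = intersection_number G 2 1 1"

text \<open>Intended for graphs whose vertex set is the whole type, \<open>pverts G = UNIV\<close>.\<close>

definition q_distance_matrix :: "'a::finite pair_pre_digraph \<Rightarrow> real \<Rightarrow> real^'a^'a" where
  "q_distance_matrix G q =
     (\<chi> x y. if x = y then 0 else (\<Sum>i<graph_dist G x y. 1 / q ^ i))"

definition eigenspace :: "real^'n^'n \<Rightarrow> real \<Rightarrow> (real^'n) set" where
  "eigenspace A \<theta> = {v. A *v v = \<theta> *\<^sub>R v}"

definition is_eigenvalue :: "real^'n^'n \<Rightarrow> real \<Rightarrow> bool" where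
  "is_eigenvalue A \<theta> \<longleftrightarrow> (\<exists>v. v \<noteq> 0 \<and> A *v v = \<theta> *\<^sub>R v)"

text \<open>
  Eigenvalues are counted with multiplicity, which for a symmetric matrix is the dimension of the
  eigenspace. Without multiplicities the theorem would fail: for the 4-cycle and
  $-1/3 < q < 0$ the only positive value in the spectrum is $-1 - 1/q$, with multiplicity 2.
\<close>

definition num_pos_eigenvalues :: "real^'n^'n \<Rightarrow> nat" where
  "num_pos_eigenvalues A = (\<Sum>\<theta> | is_eigenvalue A \<theta> \<and> \<theta> > 0. dim (eigenspace A \<theta>))"

end

theory Submission
  imports Defs
begin

text \<open>
  A matrix with exactly one positive eigenvalue is not positive definite on any plane. If \<open>q < 0\<close>,
  an induced path on three vertices spans such a plane, as the entry at distance \<open>2\<close> is negative.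
  If \<open>q > 0\<close>, the row sums are constant and positive, so the all-ones vector takes up the
  positive eigenvalue and the form is nonpositive on weights with sum \<open>0\<close>. Hence every explicit
  system of weights with positive value excludes a configuration. Quadrangles are excluded, and if
  \<open>c\<^sub>2 \<ge> 2\<close>, the neighbourhood graphs are regular, their nonadjacent vertices have
  \<open>c\<^sub>2 - 1\<close> pairwise adjacent common neighbours, and further small subgraphs are excluded. This forces
  the neighbourhood graphs to have no claws and then to be pentagons. So a vertex and its
  neighbours lie in an icosahedron, and two antipodal pairs of it contradict \<open>q < 1\<close>.
\<close>

section \<open>Positive eigenvectors of symmetric matrices\<close>

lemma symmetric_inner_matrix_vector_mult:
  fixes A :: "real^'n^'n"
  assumes "transpose A = A"
  shows "u \<bullet> (A *v v) = (A *v u) \<bullet> v"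
  using assms by (metis dot_lmul_matrix vector_transpose_matrix)

text \<open>The case \<open>u = 0\<close> is allowed; it gives an eigenvector without side condition.\<close>
lemma positive_eigenvector_orthogonal:
  fixes A :: "real^'n^'n"
  assumes sym: "transpose A = A" and u: "A *v u = \<mu> *\<^sub>R u"
    and w: "u \<bullet> w = 0" "w \<bullet> (A *v w) > 0"
  obtains v l where "v \<noteq> 0" "u \<bullet> v = 0" "l > 0" "A *v v = l *\<^sub>R v"
proof -
  define S where "S = {x. u \<bullet> x = 0} \<inter> sphere 0 1"
  define Q where "Q x = x \<bullet> (A *v x)" for x
  have w0: "w \<noteq> 0" using w(2) by auto
  define w' where "w' = (1 / norm w) *\<^sub>R w"
  have w'S: "w' \<in> S" using w0 w(1) by (simp add: S_def w'_def)
  have Qscale: "Q (c *\<^sub>R x) = c^2 * Q x" for c x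
    by (simp add: Q_def matrix_vector_mult_scaleR power2_eq_square)
  have "compact S" unfolding S_def
    by (intro closed_Int_compact closed_hyperplane compact_sphere)
  moreover have "continuous_on S Q" unfolding Q_def
    by (intro continuous_intros matrix_vector_mult_linear_continuous_on)
  ultimately obtain x where x: "x \<in> S" and max: "\<And>y. y \<in> S \<Longrightarrow> Q y \<le> Q x"
    using continuous_attains_sup[of S Q] w'S by blast
  define l where "l = Q x"
  have "0 < Q w'" using w(2) w0 Qscale[of _ w] by (simp add: w'_def Q_def)
  then have pos: "l > 0" using max[OF w'S] by (simp add: l_def)
  have x1: "x \<bullet> x = 1" "u \<bullet> x = 0" using x by (auto simp: S_def dot_square_norm)
  \<comment> \<open>By homogeneity \<open>g\<close> is nonpositive on the whole hyperplane, and it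
    vanishes at the maximiser \<open>x\<close>. The residual \<open>z\<close> is the direction in
    which the Rayleigh quotient would grow, so it must be \<open>0\<close>.\<close>
  define g where "g y = Q y - l * (y \<bullet> y)" for y
  have g_le: "g y \<le> 0" if "u \<bullet> y = 0" for y
  proof (cases "y = 0")
    case False
    have "Q ((1 / norm y) *\<^sub>R y) \<le> l"
      unfolding l_def using False that by (intro max) (simp add: S_def)
    then show ?thesis using False
      by (simp add: Qscale g_def divide_simps power2_norm_eq_inner[symmetric])
  qed (simp add: g_def Q_def)
  define z where "z = A *v x - l *\<^sub>R x"
  have uz: "u \<bullet> z = 0"
    using x1 u by (simp add: z_def inner_diff_right symmetric_inner_matrix_vector_mult[OF sym])
  have expand: "g (x + e *\<^sub>R z) = 2 * e * (z \<bullet> z) + e^2 * g z" for e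
  proof -
    have "A *v x = z + l *\<^sub>R x" by (simp add: z_def)
    then have "z \<bullet> (A *v x) = z \<bullet> z + l * (x \<bullet> z)" by (simp add: inner_add_right inner_commute)
    moreover have "x \<bullet> (A *v z) = z \<bullet> (A *v x)"
      using symmetric_inner_matrix_vector_mult[OF sym] by (simp add: inner_commute)
    moreover have "x \<bullet> (A *v x) = l" by (simp add: l_def Q_def)
    ultimately show ?thesis using x1(1)
      by (simp add: g_def Q_def matrix_vector_right_distrib matrix_vector_mult_scaleR
          inner_add_left inner_add_right inner_commute power2_eq_square algebra_simps)
  qed
  have "z \<bullet> z = 0"
  proof (rule ccontr)
    assume "z \<bullet> z \<noteq> 0"
    then have zz: "z \<bullet> z > 0" by (simp add: less_le)
    have gz: "g z \<le> 0" using g_le uz by simp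
    \<comment> \<open>This \<open>e\<close> makes \<open>e * g z = e - z \<bullet> z\<close>, so the
      quadratic term cannot cancel the linear term \<open>2 * (z \<bullet> z)\<close>.\<close>
    define e where "e = (z \<bullet> z) / (1 + \<bar>g z\<bar>)"
    have e: "e > 0" "e * (1 + \<bar>g z\<bar>) = z \<bullet> z" using zz by (auto simp: e_def)
    have "g (x + e *\<^sub>R z) \<le> 0" using uz x1 by (intro g_le) (simp add: inner_add_right)
    then have "e * (2 * (z \<bullet> z) + e * g z) \<le> 0"
      by (simp add: expand power2_eq_square algebra_simps)
    then have "2 * (z \<bullet> z) + e * g z \<le> 0" using e(1) by (simp add: mult_le_0_iff)
    moreover have "e * g z = e - z \<bullet> z" using e(2) gz by (simp add: algebra_simps)
    ultimately show False using zz e(1) by linarith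
  qed
  then have "A *v x = l *\<^sub>R x" by (simp add: z_def)
  then show ?thesis using that[of x l] x1 pos by fastforce
qed

text \<open>The form is positive definite on the span of \<open>v\<close> and \<open>w\<close>. This
  plane meets the hyperplane orthogonal to a positive eigenvector \<open>x\<close>, which yields a
  second positive eigenvector orthogonal to \<open>x\<close>.\<close>

lemma one_pos_eigenvalue_no_pos_plane:
  fixes A :: "real^'n^'n"
  assumes sym: "transpose A = A" and one: "num_pos_eigenvalues A = 1"
    and v: "v \<bullet> (A *v v) > 0" and w: "w \<bullet> (A *v w) > 0" and vw: "v \<bullet> (A *v w) = 0"
  shows False
proof -
  obtain x l where x: "x \<noteq> 0" "l > 0" "A *v x = l *\<^sub>R x"
    using positive_eigenvector_orthogonal[OF sym, of 0 0 v] v by auto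
  \<comment> \<open>The combination of \<open>v\<close> and \<open>w\<close> that is orthogonal to
    \<open>x\<close>; if \<open>x \<bullet> v = 0\<close>, then \<open>v\<close> itself
    serves.\<close>
  define y where "y = (x \<bullet> w) *\<^sub>R v - (x \<bullet> v) *\<^sub>R w"
  have wv: "w \<bullet> (A *v v) = 0"
    using vw symmetric_inner_matrix_vector_mult[OF sym] by (metis inner_commute)
  have "\<exists>y. x \<bullet> y = 0 \<and> y \<bullet> (A *v y) > 0"
  proof (cases "x \<bullet> v = 0")
    case False
    have "y \<bullet> (A *v y) = (x \<bullet> w)^2 * (v \<bullet> (A *v v)) + (x \<bullet> v)^2 * (w \<bullet> (A *v w))"
      by (simp add: y_def matrix_vector_mult_diff_distrib matrix_vector_mult_scaleR
          inner_diff_left inner_diff_right vw wv power2_eq_square)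
    moreover have "(x \<bullet> v)^2 * (w \<bullet> (A *v w)) > 0" using False w by simp
    moreover have "(x \<bullet> w)^2 * (v \<bullet> (A *v v)) \<ge> 0" using v by simp
    moreover have "x \<bullet> y = 0" by (simp add: y_def inner_diff_right)
    ultimately show ?thesis by (intro exI[of _ y]) linarith
  qed (use v in blast)
  then obtain z \<mu> where z: "z \<noteq> 0" "x \<bullet> z = 0" "\<mu> > 0" "A *v z = \<mu> *\<^sub>R z"
    using positive_eigenvector_orthogonal[OF sym x(3)] by metis
  let ?P = "{\<theta>. is_eigenvalue A \<theta> \<and> \<theta> > 0}"
  have P: "l \<in> ?P" "\<mu> \<in> ?P" using x z by (auto simp: is_eigenvalue_def)
  \<comment> \<open>A sum over an infinite set is \<open>0\<close> by convention, so the value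
    \<open>1\<close> forces finiteness.\<close>
  have fin: "finite ?P"
    using one sum.infinite[of ?P "\<lambda>\<theta>. dim (eigenspace A \<theta>)"]
    by (auto simp: num_pos_eigenvalues_def)
  have dim1: "dim (eigenspace A \<theta>) \<ge> card B"
    if "B \<subseteq> eigenspace A \<theta>" "independent B" for \<theta> B
    using independent_card_le_dim[OF that] .
  show False
  proof (cases "l = \<mu>")
    case True
    have "independent {x, z}"
      using x(1) z(1,2) by (intro pairwise_orthogonal_independent)
        (auto simp: pairwise_def orthogonal_def inner_commute)
    moreover have "x \<noteq> z" using x(1) z(2) by auto
    ultimately have "dim (eigenspace A l) \<ge> 2"
      using dim1[of "{x, z}" l] x z True by (auto simp: eigenspace_def)
    moreover have "dim (eigenspace A l) \<le> num_pos_eigenvalues A"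
      unfolding num_pos_eigenvalues_def using fin P by (intro member_le_sum) auto
    ultimately show False using one by simp
  next
    case False
    have "dim (eigenspace A l) \<ge> 1"
      using dim1[of "{x}" l] x by (auto simp: eigenspace_def)
    moreover have "dim (eigenspace A \<mu>) \<ge> 1"
      using dim1[of "{z}" \<mu>] z by (auto simp: eigenspace_def)
    moreover have "(\<Sum>\<theta>\<in>{l, \<mu>}. dim (eigenspace A \<theta>)) \<le> num_pos_eigenvalues A"
      unfolding num_pos_eigenvalues_def using fin P by (intro sum_mono2) auto
    ultimately show False using one False by simp
  qed
qed

section \<open>Neighbourhood graphs\<close>

text \<open>Models the graph induced on the neighbours of one vertex; there \<open>m\<close> will be
  \<open>c2 - 1\<close>. The last three assumptions exclude induced subgraphs:
  \<open>K_{1,1,3}\<close>, the affine Dynkin diagram D5 with central edge \<open>w x\<close>, and a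
  \<open>K_4\<close> on \<open>w, v, x, y\<close> with triangles \<open>z w v\<close> and
  \<open>p x y\<close> glued to opposite edges.\<close>

locale local_graph =
  fixes V :: "'a set" and R :: "'a \<Rightarrow> 'a \<Rightarrow> bool" and a m :: nat
  assumes finite_V: "finite V"
    and adj_in_V: "R x y \<Longrightarrow> x \<in> V"
    and irrefl: "\<not> R x x"
    and sym: "R x y \<Longrightarrow> R y x"
    and degree: "x \<in> V \<Longrightarrow> card {y. R x y} = a"
    and mu: "\<lbrakk>x \<in> V; y \<in> V; x \<noteq> y; \<not> R x y\<rbrakk> \<Longrightarrow> card {z. R x z \<and> R y z} = m"
    and m_pos: "m > 0"
    and common_nbrs_clique: "\<lbrakk>R x u; R u y; R y v; R v x; x \<noteq> y; \<not> R x y; u \<noteq> v\<rbrakk> \<Longrightarrow> R u v"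
    and no_K113: "\<lbrakk>R w p; R w x; R w y; R w z; R p x; R p y; R p z;
      x \<noteq> y; x \<noteq> z; y \<noteq> z; \<not> R x y; \<not> R x z; \<not> R y z\<rbrakk> \<Longrightarrow> False"
    and no_affine_D5: "\<lbrakk>R w x; R w y; R w z; R x p; R x p'; x \<noteq> y; x \<noteq> z; y \<noteq> z; p \<noteq> p';
      w \<noteq> p; w \<noteq> p'; \<not> R x y; \<not> R x z; \<not> R y z; \<not> R w p; \<not> R w p'; \<not> R p p';
      \<not> R y p; \<not> R y p'; \<not> R z p; \<not> R z p'\<rbrakk> \<Longrightarrow> False"
    and no_tailed_K4: "\<lbrakk>R w v; R x y; R w x; R w y; R v x; R v y; R z w; R z v; R p x; R p y;
      z \<noteq> p; z \<noteq> x; z \<noteq> y; p \<noteq> w; p \<noteq> v;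
      \<not> R z x; \<not> R z y; \<not> R p w; \<not> R p v; \<not> R z p\<rbrakk> \<Longrightarrow> False"
begin

definition nbrs :: "'a \<Rightarrow> 'a set" where
  "nbrs x = {y. R x y}"

definition common :: "'a \<Rightarrow> 'a \<Rightarrow> 'a set" where
  "common x y = {z. R x z \<and> R y z}"

definition far :: "'a \<Rightarrow> 'a \<Rightarrow> 'a set" where
  "far w y = {p. R y p \<and> \<not> R w p \<and> p \<noteq> w}"

definition pentagon :: "'a \<Rightarrow> 'a \<Rightarrow> 'a \<Rightarrow> 'a \<Rightarrow> 'a \<Rightarrow> bool" where
  "pentagon v0 v1 v2 v3 v4 \<longleftrightarrow> R v0 v1 \<and> R v1 v2 \<and> R v2 v3 \<and> R v3 v4 \<and> R v4 v0 \<and>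
     \<not> R v0 v2 \<and> \<not> R v1 v3 \<and> \<not> R v2 v4 \<and> \<not> R v3 v0 \<and> \<not> R v4 v1"

lemma adj_in_V2: "R x y \<Longrightarrow> y \<in> V"
  using adj_in_V sym by blast

lemma sym_iff: "R x y \<longleftrightarrow> R y x"
  using sym by blast

lemma finite_nbrs [simp]: "finite (nbrs x)"
  using adj_in_V2 by (intro finite_subset[OF _ finite_V]) (auto simp: nbrs_def)

lemma finite_common [simp]: "finite (common x y)"
  by (rule finite_subset[OF _ finite_nbrs[of x]]) (auto simp: nbrs_def common_def)

lemma finite_far [simp]: "finite (far w y)"
  by (rule finite_subset[OF _ finite_nbrs[of y]]) (auto simp: nbrs_def far_def)

lemma common_commute: "common x y = common y x"
  by (auto simp: common_def)

lemma card_nbrs: "R x y \<Longrightarrow> card (nbrs x) = a"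
  using degree adj_in_V by (simp add: nbrs_def)

lemma card_closed_nbrs: "R x y \<Longrightarrow> card (insert x (nbrs x)) = a + 1"
  using card_nbrs[of x y] irrefl[of x] card_insert_disjoint[OF finite_nbrs, of x x]
  by (simp add: nbrs_def)

lemma card_common: "\<lbrakk>R x u; R y v; x \<noteq> y; \<not> R x y\<rbrakk> \<Longrightarrow> card (common x y) = m"
  using mu adj_in_V by (simp add: common_def)

lemma common_adj: "\<lbrakk>u \<in> common x y; v \<in> common x y; x \<noteq> y; \<not> R x y; u \<noteq> v\<rbrakk> \<Longrightarrow> R u v"
  using common_nbrs_clique[of x u y v] by (auto simp: sym_iff common_def)

section \<open>Claws in neighbourhood graphs\<close>

text \<open>If \<open>p\<close> were adjacent to \<open>y\<close>, then \<open>w\<close> and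
  \<open>p\<close> would be nonadjacent common neighbours of \<open>y\<close> and \<open>z\<close>.
  If \<open>p\<close> had no neighbour in \<open>far w y\<close>, every common neighbour of
  \<open>y\<close> and \<open>p\<close> would be adjacent to \<open>w\<close>, hence to
  \<open>z\<close>, and thus be one of only \<open>m - 1\<close> vertices.\<close>

lemma far_nbr:
  assumes wy: "R w y" and wz: "R w z" and yz: "y \<noteq> z" "\<not> R y z" and p: "p \<in> far w z"
  shows "\<not> R y p" and "\<exists>r\<in>far w y. R r p"
proof -
  have p': "R z p" "\<not> R w p" "p \<noteq> w" using p by (auto simp: far_def)
  show yp: "\<not> R y p"
    using common_adj[of w y z p] p' wy wz yz by (auto simp: sym_iff common_def)
  show "\<exists>r\<in>far w y. R r p"
  proof (rule ccontr)
    assume none: "\<not> (\<exists>r\<in>far w y. R r p)"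
    have "common y p \<subseteq> common y z - {w}"
    proof
      fix t assume "t \<in> common y p"
      then have t: "R y t" "R p t" by (auto simp: common_def)
      then have "t \<notin> far w y" using none by (auto simp: sym_iff)
      then have wt: "R w t" using t p' by (auto simp: sym_iff far_def)
      have "t \<noteq> z" using t yz by auto
      then have "R z t"
        using common_nbrs_clique[of w z p t] wt t p' wz by (auto simp: sym_iff)
      then show "t \<in> common y z - {w}" using t wt irrefl by (auto simp: common_def)
    qed
    then have "card (common y p) \<le> card (common y z - {w})" by (intro card_mono) auto
    moreover have "card (common y z - {w}) < card (common y z)"
      using sym[OF wy] sym[OF wz] by (intro card_Diff1_less finite_common) (simp add: common_def)
    moreover have "y \<noteq> p" using p' wy by auto
    ultimately show False
      using card_common[of y w p z] card_common[of y w z w] wy wz yz yp p' by (auto simp: sym_iff)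
  qed
qed

text \<open>The traces on \<open>far w y\<close> of the neighbourhoods of the points of \<open>far w z\<close> form a chain, since
  an induced quadrangle would arise otherwise; so the largest trace is all of \<open>far w y\<close>.\<close>
lemma card_far_le:
  assumes wy: "R w y" and wz: "R w z" and yz: "y \<noteq> z" "\<not> R y z"
    and cy: "\<And>p r. \<lbrakk>p \<in> far w y; r \<in> far w y; p \<noteq> r\<rbrakk> \<Longrightarrow> R p r"
    and cz: "\<And>p r. \<lbrakk>p \<in> far w z; r \<in> far w z; p \<noteq> r\<rbrakk> \<Longrightarrow> R p r"
  shows "card (far w y) \<le> m"
proof (cases "far w y = {}")
  case False
  have nb_y: "\<exists>r\<in>far w y. R r p" if "p \<in> far w z" for p
    using far_nbr(2)[OF wy wz yz that] .
  have nb_z: "\<exists>r\<in>far w z. R r p" if "p \<in> far w y" for p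
    using far_nbr(2)[OF wz wy yz(1)[symmetric] _ that] yz(2) by (simp add: sym_iff[of z y])
  let ?c = "\<lambda>p. card (nbrs p \<inter> far w y)"
  have ne: "far w z \<noteq> {}" using nb_z False by blast
  have "Max (?c ` far w z) \<in> ?c ` far w z" using ne by (intro Max_in) auto
  then obtain p where p: "p \<in> far w z" and cp: "?c p = Max (?c ` far w z)" by force
  have max: "?c t \<le> ?c p" if "t \<in> far w z" for t
    unfolding cp using that by (intro Max_ge) auto
  have all: "R r p" if r: "r \<in> far w y" for r
  proof (rule ccontr)
    assume rp: "\<not> R r p"
    obtain p' where p': "p' \<in> far w z" "R p' r" using nb_z[OF r] by blast
    have pp': "p \<noteq> p'" using p' rp by (auto simp: sym_iff)
    have "nbrs p \<inter> far w y \<subset> nbrs p' \<inter> far w y"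
    proof
      show "nbrs p \<inter> far w y \<subseteq> nbrs p' \<inter> far w y"
      proof
        fix t assume "t \<in> nbrs p \<inter> far w y"
        then have t: "R p t" "t \<in> far w y" by (auto simp: nbrs_def)
        have tr: "t \<noteq> r" using t rp by (auto simp: sym_iff)
        have "r \<noteq> p" using far_nbr(1)[OF wy wz yz p] r by (auto simp: far_def)
        \<comment> \<open>In the cycle \<open>r, p', p, t\<close> the vertices \<open>r\<close> and
          \<open>p\<close> are not adjacent, so the other diagonal must be an edge.\<close>
        then have "R p' t"
          using common_nbrs_clique[of r p' p t] p' cz[OF p p'(1) pp'] t cy[OF t(2) r tr] rp sym
          using far_nbr(1)[OF wy wz yz p'(1)] by (auto simp: far_def)
        then show "t \<in> nbrs p' \<inter> far w y" using t by (simp add: nbrs_def)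
      qed
      show "nbrs p \<inter> far w y \<noteq> nbrs p' \<inter> far w y"
        using r p' rp by (auto simp: sym_iff nbrs_def)
    qed
    then have "?c p < ?c p'" by (intro psubset_card_mono) auto
    then show False using max[OF p'(1)] by simp
  qed
  have "far w y \<subseteq> common y p" using all by (auto simp: sym_iff common_def far_def)
  then have "card (far w y) \<le> card (common y p)" by (intro card_mono) auto
  also have "\<dots> = m"
    using p wy far_nbr(1)[OF wy wz yz p] sym by (intro card_common[of y w p z]) (auto simp: far_def)
  finally show ?thesis .
qed simp

text \<open>For a claw with centre \<open>w\<close> and leaves \<open>x, y, z\<close>, regularity makes \<open>far w x\<close> larger than
  \<open>m\<close>, while the forbidden subgraphs make the sets \<open>far w x\<close> and \<open>far w y\<close> cliques.\<close>
lemma no_claw: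
  assumes w: "R w x" "R w y" "R w z" and ne: "x \<noteq> y" "x \<noteq> z" "y \<noteq> z"
    and na: "\<not> R x y" "\<not> R x z" "\<not> R y z"
  shows False
proof -
  \<comment> \<open>Two nonadjacent points of \<open>far w x\<close> would be the leaves at
    \<open>x\<close> of an affine D5 whose leaves at \<open>w\<close> are \<open>y\<close> and
    \<open>z\<close>.\<close>
  have clique: "R p r"
    if "R w x" "R w y" "R w z" "x \<noteq> y" "x \<noteq> z" "y \<noteq> z" "\<not> R x y" "\<not> R x z" "\<not> R y z"
      and "p \<in> far w x" "r \<in> far w x" "p \<noteq> r" for x y z p r
  proof -
    have "\<not> R y p" "\<not> R y r" "\<not> R z p" "\<not> R z r"
      using that far_nbr(1)[of w y x] far_nbr(1)[of w z x] by (auto simp: sym_iff)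
    then show ?thesis
      using that no_affine_D5[of w x y z p r] by (auto simp: far_def)
  qed
  have "card (far w x) \<le> m"
    using w ne na sym clique[of x y z] clique[of y x z]
    by (intro card_far_le[of w x y]) blast+
  define I where "I = nbrs w \<inter> nbrs x"
  have fI: "finite I" by (simp add: I_def)
  have wx: "w \<notin> I" "x \<notin> I" using irrefl by (auto simp: I_def nbrs_def)
  have "nbrs x = insert w (I \<union> far w x)"
    using w by (auto simp: sym_iff I_def nbrs_def far_def)
  moreover have "w \<notin> I \<union> far w x" using irrefl by (auto simp: I_def nbrs_def far_def)
  moreover have "I \<inter> far w x = {}" by (auto simp: I_def nbrs_def far_def)
  ultimately have a1: "a = Suc (card I + card (far w x))"
    using card_nbrs[of x w] w sym fI by (simp add: card_Un_disjoint)
  \<comment> \<open>These \<open>m - 1\<close> vertices are adjacent to \<open>w\<close>, as common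
    neighbours of \<open>y\<close> and \<open>z\<close> form a clique, but not to \<open>x\<close>,
    by \<open>no_K113\<close>.\<close>
  define K where "K = common y z - {w}"
  have K: "R w t \<and> R y t \<and> R z t \<and> \<not> R x t" if t: "t \<in> K" for t
  proof -
    have wt: "R w t" using that common_adj[of w y z t] w ne na by (auto simp: sym_iff K_def common_def)
    moreover have "R y t" "R z t" using t by (auto simp: K_def common_def)
    ultimately show ?thesis using no_K113[of w t x y z] w ne na by (auto simp: sym_iff)
  qed
  have cK: "card K = m - 1"
    using card_common[of y w z w] w ne na sym by (simp add: K_def common_def)
  have fK: "finite K" by (simp add: K_def)
  \<comment> \<open>Counting at \<open>w\<close> gives \<open>a >= card I + m + 2\<close>, whereas
    counting at \<open>x\<close> gives \<open>a <= card I + m + 1\<close>.\<close>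
  have "I \<union> ({x, y, z} \<union> K) \<subseteq> nbrs w" using K w by (auto simp: I_def nbrs_def)
  then have "card (I \<union> ({x, y, z} \<union> K)) \<le> a"
    using card_mono[OF finite_nbrs] card_nbrs[OF w(1)] by metis
  moreover have "I \<inter> ({x, y, z} \<union> K) = {}"
    using K na irrefl by (auto simp: I_def nbrs_def)
  moreover have "{x, y, z} \<inter> K = {}" using K na irrefl by (auto simp: sym_iff)
  moreover have "card {x, y, z} = 3" using ne by simp
  ultimately have "card I + (3 + (m - 1)) \<le> a"
    using fI fK cK card_Un_disjoint[of I "{x, y, z} \<union> K"] card_Un_disjoint[of "{x, y, z}" K] by simp
  then show False using a1 \<open>card (far w x) \<le> m\<close> m_pos by linarith
qed

section \<open>Induced pentagons in neighbourhood graphs\<close>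

lemma pentagon_exists:
  assumes "y \<in> V" "z \<in> V" "y \<noteq> z" "\<not> R y z"
  obtains v0 v1 v2 v3 v4 where "pentagon v0 v1 v2 v3 v4"
proof -
  have "card {t. R y t \<and> R z t} > 0" using mu[OF assms] m_pos by simp
  then obtain w where w: "R y w" "R z w" by (metis (mono_tags, lifting) Collect_empty_eq card.empty less_irrefl)
  \<comment> \<open>Closed neighbourhoods have equal size and \<open>z\<close> is adjacent to
    \<open>w\<close> only, so \<open>y\<close> also has a neighbour \<open>p\<close> outside that of
    \<open>w\<close>.\<close>
  have "\<not> insert y (nbrs y) \<subseteq> insert w (nbrs w)"
  proof
    assume sub: "insert y (nbrs y) \<subseteq> insert w (nbrs w)"
    moreover have "card (insert y (nbrs y)) = card (insert w (nbrs w))"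
      using card_closed_nbrs[of y w] card_closed_nbrs[of w y] w sym by simp
    ultimately have "insert y (nbrs y) = insert w (nbrs w)"
      by (intro card_subset_eq) auto
    moreover have "z \<in> nbrs w" using w by (auto simp: sym_iff nbrs_def)
    ultimately show False using assms by (auto simp: nbrs_def)
  qed
  then obtain p where p: "R y p" "\<not> R w p" "p \<noteq> w" using w by (auto simp: sym_iff nbrs_def)
  have pz: "\<not> R p z" "p \<noteq> z"
    using common_adj[of p y z w] p w assms by (auto simp: sym_iff common_def)
  \<comment> \<open>Both pairs have \<open>m\<close> common neighbours and \<open>w\<close> is lost
    on passing from \<open>y\<close> to \<open>p\<close>, so a new vertex \<open>r\<close> appears.
    It closes the pentagon \<open>w, y, p, r, z\<close>.\<close>
  have "\<not> common p z \<subseteq> common y z - {w}"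
  proof
    assume "common p z \<subseteq> common y z - {w}"
    then have "card (common p z) \<le> card (common y z - {w})" by (intro card_mono) auto
    moreover have "card (common y z - {w}) < card (common y z)"
      using w by (intro card_Diff1_less finite_common) (simp add: common_def)
    ultimately show False
      using card_common[of p y z w] card_common[of y w z w] p w pz assms by (auto simp: sym_iff)
  qed
  then obtain r where r: "R p r" "R z r" "\<not> R y r \<or> r = w" by (auto simp: common_def)
  have ry: "\<not> R y r" using r p by (auto simp: sym_iff)
  have "y \<noteq> r" using r assms by (auto simp: sym_iff)
  then have "\<not> R r w"
    using common_nbrs_clique[of w r p y] common_nbrs_clique[of y w r p] r p w ry pz by (auto simp: sym_iff)
  then have "pentagon w y p r z"
    using p w r ry pz assms by (auto simp: sym_iff pentagon_def)
  then show ?thesis using that by blast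
qed

lemma pentagon_rotate: "pentagon v0 v1 v2 v3 v4 \<Longrightarrow> pentagon v1 v2 v3 v4 v0"
  by (auto simp: sym_iff pentagon_def)

lemma pentagon_reflect: "pentagon v0 v1 v2 v3 v4 \<Longrightarrow> pentagon v0 v4 v3 v2 v1"
  by (auto simp: sym_iff pentagon_def)

lemma pentagon_distinct:
  "pentagon v0 v1 v2 v3 v4 \<Longrightarrow> distinct [v0, v1, v2, v3, v4]"
  using sym irrefl by (auto simp: pentagon_def)

lemma pentagon_common:
  assumes "pentagon v0 v1 v2 v3 v4"
  shows "card (common v0 v2) = m" "card (common v0 v3) = m" "card (common v1 v4) = m"
  using assms pentagon_distinct[OF assms]
    card_common[of v0 v1 v2 v1] card_common[of v0 v1 v3 v4] card_common[of v1 v0 v4 v0]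
  by (auto simp: sym_iff pentagon_def)

text \<open>The \<open>m\<close> common neighbours of \<open>q\<close> and \<open>v3\<close> are all
  adjacent to \<open>v1\<close> or all adjacent to \<open>v0\<close>, since a mixed pair would close
  an induced quadrangle with the edge \<open>v0 v1\<close>. But \<open>v2\<close> or
  \<open>v4\<close> is then a further common neighbour on that side, which makes
  \<open>m + 1\<close>.\<close>

lemma no_pentagon_triangle:
  assumes P: "pentagon v0 v1 v2 v3 v4"
    and q: "R q v0" "R q v1" "\<not> R q v2" "\<not> R q v3" "\<not> R q v4"
  shows False
proof -
  have D: "v0 \<noteq> v1" "v0 \<noteq> v2" "v0 \<noteq> v3" "v0 \<noteq> v4" "v1 \<noteq> v2" "v1 \<noteq> v3" "v1 \<noteq> v4"
    "v2 \<noteq> v3" "v2 \<noteq> v4" "v3 \<noteq> v4" using pentagon_distinct[OF P] by auto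
  have A: "R v0 v1" "R v1 v2" "R v2 v3" "R v3 v4" "R v4 v0"
     "\<not> R v0 v2" "\<not> R v1 v3" "\<not> R v2 v4" "\<not> R v3 v0" "\<not> R v4 v1"
    using P by (auto simp: pentagon_def)
  have qn: "q \<noteq> v0" "q \<noteq> v1" "q \<noteq> v2" "q \<noteq> v3" "q \<noteq> v4" using q A sym irrefl by blast+
  have cq: "card (common q v3) = m" using q A qn sym by (intro card_common[of q v0 v3 v4]) auto
  have cases: "b \<in> common v1 v3 \<or> b \<in> common v0 v3" if "b \<in> common q v3" for b
  proof -
    have b: "R q b" "R v3 b" using that by (auto simp: common_def)
    have bn: "b \<noteq> v2" "b \<noteq> v4" "b \<noteq> v0" "b \<noteq> v1" using b q A by (auto simp: sym_iff)
    \<comment> \<open>Otherwise \<open>v3\<close> is the centre of a claw; in either case a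
      quadrangle through \<open>q\<close> then makes \<open>b\<close> adjacent to \<open>v1\<close>
      or \<open>v0\<close>.\<close>
    have "R b v2 \<or> R b v4"
      using no_claw[of v3 v2 v4 b] b A D bn by (auto simp: sym_iff)
    then show ?thesis
    proof
      assume b2: "R b v2"
      have "R v1 b"
        using common_nbrs_clique[of v2 b q v1] b b2 q A bn qn by (auto simp: sym_iff)
      then show ?thesis using b by (simp add: common_def)
    next
      assume b4: "R b v4"
      have "R v0 b"
        using common_nbrs_clique[of v4 b q v0] b b4 q A bn qn by (auto simp: sym_iff)
      then show ?thesis using b by (simp add: common_def)
    qed
  qed
  have both: False if "b \<in> common q v3" "b \<in> common v1 v3" "b \<in> common v0 v3" for b
  proof -
    have b: "R q b" "R v3 b" "R v1 b" "R v0 b" using that by (auto simp: common_def)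
    have "b \<noteq> v2" "b \<noteq> v4" using b A by (auto simp: sym_iff)
    then have "R b v2" "R b v4"
      using common_adj[of b v1 v3 v2] common_adj[of b v0 v3 v4] b A D by (auto simp: sym_iff common_def)
    then show False using no_claw[of b q v2 v4] b q A D qn by (auto simp: sym_iff)
  qed
  have "common q v3 \<subseteq> common v1 v3 \<or> common q v3 \<subseteq> common v0 v3"
  proof (rule ccontr)
    assume "\<not> ?thesis"
    then obtain b b' where b: "b \<in> common q v3" "b \<in> common v1 v3" "b \<notin> common v0 v3"
      and b': "b' \<in> common q v3" "b' \<in> common v0 v3" "b' \<notin> common v1 v3"
      using cases by blast
    then have "b \<noteq> b'" by blast
    then have "R b b'" using common_adj[OF b(1) b'(1)] q qn by blast
    then show False
      using common_nbrs_clique[of b b' v0 v1] b b' A by (auto simp: sym_iff common_def)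
  qed
  moreover have "v2 \<in> common v1 v3" "v2 \<notin> common q v3" "v4 \<in> common v0 v3" "v4 \<notin> common q v3"
    using A q by (auto simp: sym_iff common_def)
  ultimately have "common q v3 \<subset> common v1 v3 \<or> common q v3 \<subset> common v0 v3" by blast
  then have "card (common q v3) < card (common v1 v3) \<or> card (common q v3) < card (common v0 v3)"
    using psubset_card_mono finite_common by metis
  moreover have "card (common v1 v3) = m" "card (common v0 v3) = m"
    using pentagon_common[OF P] pentagon_common[OF pentagon_rotate[OF P]] by auto
  ultimately show False using cq by simp
qed

text \<open>Without claws, a neighbour of \<open>v0\<close> off the pentagon is adjacent to
  \<open>v1\<close> or \<open>v4\<close>, and by \<open>no_pentagon_triangle\<close> to a third
  vertex of the pentagon. The three sets on the right are cliques, which the following counts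
  exploit.\<close>

lemma pentagon_closed_nbrs:
  assumes P: "pentagon v0 v1 v2 v3 v4"
  shows "insert v0 (nbrs v0) = common v1 v4 \<union> common v0 v2 \<union> common v0 v3"
proof -
  have D: "v0 \<noteq> v1" "v0 \<noteq> v4" "v1 \<noteq> v4" using pentagon_distinct[OF P] by auto
  have A: "R v0 v1" "R v1 v2" "R v2 v3" "R v3 v4" "R v4 v0" "\<not> R v4 v1"
    using P by (auto simp: pentagon_def)
  have "t \<in> nbrs v0" if "t \<in> common v1 v4" "t \<noteq> v0" for t
    using that common_adj[of v0 v1 v4 t] A D by (auto simp: sym_iff nbrs_def common_def)
  moreover have "t \<in> common v1 v4 \<union> common v0 v2 \<union> common v0 v3" if "R v0 t" for t
  proof -
    have "t = v1 \<or> t = v4 \<or> R t v1 \<or> R t v4"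
      using no_claw[of v0 v1 v4 t] A D that by (auto simp: sym_iff)
    then consider "t = v1" | "t = v4" | "R t v1" | "R t v4" by blast
    then show ?thesis
    proof cases
      case 3 then show ?thesis
        using no_pentagon_triangle[OF P, of t] that by (auto simp: sym_iff common_def)
    next
      case 4 then show ?thesis
        using no_pentagon_triangle[OF pentagon_reflect[OF P], of t] that by (auto simp: sym_iff common_def)
    qed (use A sym in \<open>auto simp: common_def\<close>)
  qed
  ultimately show ?thesis using A by (auto simp: sym_iff nbrs_def common_def)
qed

text \<open>The hub \<open>t\<close> would lie in all three cliques covering the closed
  neighbourhood of \<open>v0\<close>. Its own closed neighbourhood would contain that one, hence
  equal it by size, yet it also contains \<open>v2\<close>.\<close>

lemma no_wheel:
  assumes P: "pentagon v0 v1 v2 v3 v4"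
    and t: "R t v0" "R t v1" "R t v2" "R t v3" "R t v4"
  shows False
proof -
  have D: "v0 \<noteq> v2" "v0 \<noteq> v3" "v1 \<noteq> v4" using pentagon_distinct[OF P] by auto
  have A: "\<not> R v0 v2" "\<not> R v3 v0" "\<not> R v4 v1" using P by (auto simp: pentagon_def)
  have "insert v0 (nbrs v0) \<subseteq> insert t (nbrs t)"
  proof
    fix s assume "s \<in> insert v0 (nbrs v0)"
    then have "s \<in> common v1 v4 \<or> s \<in> common v0 v2 \<or> s \<in> common v0 v3"
      using pentagon_closed_nbrs[OF P] by blast
    moreover have "t \<in> common v1 v4" "t \<in> common v0 v2" "t \<in> common v0 v3"
      using t by (auto simp: sym_iff common_def)
    ultimately have "s = t \<or> R t s"
      using common_adj[of t _ _ s] D A sym by metis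
    then show "s \<in> insert t (nbrs t)" by (auto simp: nbrs_def)
  qed
  moreover have "card (insert v0 (nbrs v0)) = card (insert t (nbrs t))"
    using card_closed_nbrs[of v0 t] card_closed_nbrs[of t v0] t sym by simp
  ultimately have "insert v0 (nbrs v0) = insert t (nbrs t)"
    by (intro card_subset_eq) auto
  moreover have "v2 \<in> nbrs t" using t by (simp add: nbrs_def)
  ultimately show False using A D by (auto simp: nbrs_def)
qed

text \<open>Clique conditions for the pairs \<open>v1, v4\<close> and \<open>v2, v4\<close> make
  \<open>t\<close> adjacent to \<open>v0\<close> and \<open>v3\<close> too, hence a hub.\<close>

lemma no_three_nbrs_on_pentagon:
  assumes P: "pentagon v0 v1 v2 v3 v4" and t: "R t v1" "R t v4" "R t v2"
  shows False
proof -
  have D: "v1 \<noteq> v4" "v2 \<noteq> v4" using pentagon_distinct[OF P] by auto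
  have A: "R v0 v1" "R v1 v2" "R v2 v3" "R v3 v4" "R v4 v0" "\<not> R v0 v2" "\<not> R v1 v3" "\<not> R v2 v4" "\<not> R v4 v1"
    using P by (auto simp: pentagon_def)
  have "t \<noteq> v0" "t \<noteq> v3" using t A by (auto simp: sym_iff)
  then have "R t v3" "R t v0"
    using common_adj[of t v2 v4 v3] common_adj[of t v1 v4 v0] t A D by (auto simp: sym_iff common_def)
  then show False using no_wheel[OF P] t by blast
qed

text \<open>A vertex in two of the three cliques covering the closed neighbourhood would have three
  neighbours on the pentagon, so the cliques are disjoint.\<close>

lemma degree_eq:
  assumes P: "pentagon v0 v1 v2 v3 v4"
  shows "a + 1 = 3 * m"
proof -
  have "t \<notin> common v0 v2" "t \<notin> common v0 v3" if "t \<in> common v1 v4" for t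
    using that no_three_nbrs_on_pentagon[OF P, of t]
      no_three_nbrs_on_pentagon[OF pentagon_reflect[OF P], of t] by (auto simp: sym_iff common_def)
  moreover have "t \<notin> common v0 v3" if "t \<in> common v0 v2" for t
    using that no_three_nbrs_on_pentagon[OF pentagon_rotate[OF P], of t] by (auto simp: sym_iff common_def)
  ultimately have "common v1 v4 \<inter> common v0 v2 = {}" "(common v1 v4 \<union> common v0 v2) \<inter> common v0 v3 = {}"
    by blast+
  then have "card (insert v0 (nbrs v0)) = 3 * m"
    unfolding pentagon_closed_nbrs[OF P] using pentagon_common[OF P]
    by (simp add: card_Un_disjoint)
  moreover have "R v0 v1" using P by (simp add: pentagon_def)
  ultimately show ?thesis using card_closed_nbrs[of v0 v1] by simp
qed

text \<open>For \<open>m > 1\<close> there are a second common neighbour \<open>v\<close> of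
  \<open>v1, v4\<close> and a second one \<open>x\<close> of \<open>v0, v2\<close>. Then
  \<open>v0, v, v1, x\<close> form a \<open>K_4\<close> to which \<open>v4\<close> and
  \<open>v2\<close> attach as in \<open>no_tailed_K4\<close>.\<close>

lemma m_eq_1:
  assumes P: "pentagon v0 v1 v2 v3 v4"
  shows "m = 1"
proof (rule ccontr)
  assume "m \<noteq> 1"
  then have m2: "m > 1" using m_pos by simp
  have D: "v0 \<noteq> v1" "v0 \<noteq> v2" "v0 \<noteq> v3" "v0 \<noteq> v4" "v1 \<noteq> v2" "v1 \<noteq> v3" "v1 \<noteq> v4"
    "v2 \<noteq> v3" "v2 \<noteq> v4" "v3 \<noteq> v4" using pentagon_distinct[OF P] by auto
  have A: "R v0 v1" "R v1 v2" "R v2 v3" "R v3 v4" "R v4 v0"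
     "\<not> R v0 v2" "\<not> R v1 v3" "\<not> R v2 v4" "\<not> R v3 v0" "\<not> R v4 v1"
    using P by (auto simp: pentagon_def)
  have "\<not> common v1 v4 \<subseteq> {v0}" "\<not> common v0 v2 \<subseteq> {v1}"
    using pentagon_common[OF P] m2 card_mono[of "{v0}" "common v1 v4"] card_mono[of "{v1}" "common v0 v2"]
    by auto
  then obtain v x where v: "R v1 v" "R v4 v" "v \<noteq> v0" and x: "R v0 x" "R v2 x" "x \<noteq> v1"
    by (auto simp: common_def)
  have v0v: "R v0 v" using common_adj[of v0 v1 v4 v] v A D by (auto simp: sym_iff common_def)
  have v1x: "R v1 x" using common_adj[of v1 v0 v2 x] x A D by (auto simp: sym_iff common_def)
  have vn: "\<not> R v v2" "\<not> R v v3"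
    using no_three_nbrs_on_pentagon[OF P, of v]
      no_three_nbrs_on_pentagon[OF pentagon_reflect[OF P], of v] v by (auto simp: sym_iff)
  \<comment> \<open>\<open>v\<close> can replace \<open>v0\<close> in the pentagon. Comparing the
    two pentagons shows that \<open>v\<close> and \<open>v0\<close> have the same common neighbours
    with \<open>v2\<close>, among them \<open>x\<close>.\<close>
  then have P': "pentagon v v1 v2 v3 v4" using v A by (auto simp: sym_iff pentagon_def)
  have "common v v2 \<subseteq> common v0 v2"
  proof
    fix t assume "t \<in> common v v2"
    then have t: "R v t" "R v2 t" by (auto simp: common_def)
    have "t \<in> common v1 v3 \<union> common v2 v4 \<union> common v2 v0"
      using pentagon_closed_nbrs[OF pentagon_rotate[OF pentagon_rotate[OF P]]] t
      by (auto simp: nbrs_def common_commute[of v1])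
    moreover have "t \<notin> common v2 v4"
      using no_three_nbrs_on_pentagon[OF pentagon_rotate[OF pentagon_rotate[OF pentagon_rotate[OF P']]], of t] t by (auto simp: sym_iff common_def)
    moreover have "t \<notin> common v1 v3"
      using no_three_nbrs_on_pentagon[OF pentagon_reflect[OF pentagon_rotate[OF pentagon_rotate[OF P']]], of t] t by (auto simp: sym_iff common_def)
    ultimately show "t \<in> common v0 v2" by (auto simp: common_commute)
  qed
  then have "common v v2 = common v0 v2"
    using pentagon_common[OF P] pentagon_common[OF P'] by (intro card_subset_eq) auto
  then have "R v x" using x by (auto simp: common_def)
  moreover have "\<not> R v4 x"
    using no_three_nbrs_on_pentagon[OF pentagon_rotate[OF pentagon_rotate[OF pentagon_rotate[OF P]]], of x] x by (auto simp: sym_iff)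
  ultimately show False
    using no_tailed_K4[of v0 v v1 x v4 v2] v x v0v v1x vn A D sym irrefl by blast
qed

text \<open>Now \<open>a = 2\<close>, so pentagon vertices have no neighbours off the pentagon. A
  further vertex would nevertheless share a neighbour with \<open>v0\<close>.\<close>

lemma local_pentagon:
  assumes "y \<in> V" "z \<in> V" "y \<noteq> z" "\<not> R y z"
  obtains v0 v1 v2 v3 v4 where "pentagon v0 v1 v2 v3 v4" "V = {v0, v1, v2, v3, v4}" "a = 2" "m = 1"
proof -
  obtain v0 v1 v2 v3 v4 where P: "pentagon v0 v1 v2 v3 v4"
    using pentagon_exists[OF assms] .
  have m: "m = 1" using m_eq_1[OF P] .
  then have a2: "a = 2" using degree_eq[OF P] by simp
  have nbrs: "nbrs u0 = {u1, u4}" if "pentagon u0 u1 u2 u3 u4" for u0 u1 u2 u3 u4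
    using that a2 card_nbrs[of u0 u1] pentagon_distinct[OF that] sym
    by (intro card_subset_eq[symmetric] finite_nbrs) (auto simp: pentagon_def nbrs_def)
  have A: "R v0 v1" "R v1 v2" "R v2 v3" "R v3 v4" "R v4 v0" using P by (auto simp: pentagon_def)
  have "t \<in> {v0, v1, v2, v3, v4}" if "t \<in> V" for t
  proof (rule ccontr)
    assume t: "t \<notin> {v0, v1, v2, v3, v4}"
    have n: "nbrs v0 = {v1, v4}" "nbrs v1 = {v2, v0}" "nbrs v4 = {v3, v0}"
      using nbrs[OF P] nbrs[OF pentagon_rotate[OF P]] nbrs[OF pentagon_rotate[OF pentagon_reflect[OF P]]]
      by auto
    then have "\<not> R v0 t" using t by (auto simp: nbrs_def)
    then have "card {z. R v0 z \<and> R t z} = 1"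
      using mu[of v0 t] t that m adj_in_V A by auto
    then obtain s where "R v0 s" "R s t" using sym by (metis (mono_tags, lifting) card_1_singletonE mem_Collect_eq singletonI)
    then show False using n t by (auto simp: nbrs_def)
  qed
  then have "V = {v0, v1, v2, v3, v4}" using A adj_in_V by auto
  then show ?thesis using that P a2 m by blast
qed

end

section \<open>Distance functions of negative type\<close>

text \<open>The q-integer of \<open>h\<close> in base \<open>1 / q\<close>; its value
  \<open>0\<close> at \<open>h = 0\<close> accounts for the zero diagonal of the matrix.\<close>

definition q_length :: "real \<Rightarrow> nat \<Rightarrow> real" where
  "q_length q h = (\<Sum>i<h. 1 / q ^ i)"

lemma q_length_simps [simp]:
  "q_length q 0 = 0" "q_length q (Suc 0) = 1" "q_length q 2 = 1 + 1 / q"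
  "q_length q 3 = 1 + 1 / q + 1 / q ^ 2"
  by (auto simp: q_length_def numeral_2_eq_2 numeral_3_eq_3)

lemma q_length_mono: "q > 0 \<Longrightarrow> h \<le> h' \<Longrightarrow> q_length q h \<le> q_length q h'"
  unfolding q_length_def by (intro sum_mono2) auto

text \<open>Isolates what the argument needs of a distance-regular graph with
  \<open>c2 \<ge> 2\<close>. Weights come as lists of vertices with coefficients, so that the form
  on an explicit configuration can be evaluated by rewriting.\<close>

locale negative_type_graph =
  fixes d :: "'a::finite \<Rightarrow> 'a \<Rightarrow> nat" and q :: real and k a c :: nat
  assumes d_eq_0 [simp]: "d x y = 0 \<longleftrightarrow> x = y"
    and d_commute: "d x y = d y x"
    and d_triangle: "d x z \<le> d x y + d y z"
    and q_pos: "0 < q" and q_less_1: "q < 1"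
    and valency: "card {y. d x y = 1} = k"
    and card_common_adj: "d x y = 1 \<Longrightarrow> card {z. d x z = 1 \<and> d y z = 1} = a"
    and card_common_dist2: "d x y = 2 \<Longrightarrow> card {z. d x z = 1 \<and> d y z = 1} = c"
    and c_ge_2: "c \<ge> 2"
    and negative_type: "sum_list (map snd ps) = 0 \<Longrightarrow>
      (\<Sum>(x, s)\<leftarrow>ps. \<Sum>(y, t)\<leftarrow>ps. s * t * q_length q (d x y)) \<le> 0"
begin

abbreviation adj :: "'a \<Rightarrow> 'a \<Rightarrow> bool" where
  "adj x y \<equiv> d x y = 1"

lemma d_refl [simp]: "d x x = 0"
  by simp

lemma inv_q: "1 / q > 1" "1 / q ^ 2 > 1"
  using q_pos q_less_1 by (auto simp: divide_simps power_less_one_iff)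

section \<open>Configurations excluded by explicit weights\<close>

lemma dist2I:
  assumes "adj x y" "adj y z" "x \<noteq> z" "\<not> adj x z"
  shows "d x z = 2"
proof -
  have "d x z \<le> 2" using d_triangle[of x z y] assms by simp
  moreover have "d x z \<noteq> 0" using assms by simp
  ultimately show ?thesis using assms(4) by linarith
qed

text \<open>On vertices at mutual distances 1 and 2, weights \<open>s\<close> of sum 0 have the
  value \<open>-(1 + 1/q) |s|^2 - (s . A s)/q\<close>, where \<open>A\<close> is the adjacency
  matrix. Here and in the next three lemmas \<open>s . A s = -2 |s|^2\<close>, so the value is
  \<open>(1/q - 1) |s|^2\<close>, which is positive.\<close>

lemma quadrangle_chord:
  assumes "adj x u" "adj u y" "adj y v" "adj v x" "x \<noteq> y" "\<not> adj x y" "u \<noteq> v"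
  shows "adj u v"
proof (rule ccontr)
  assume "\<not> adj u v"
  then have "d x y = 2" "d u v = 2"
    using assms dist2I[of x u y] dist2I[of u y v] by auto
  then show False
    using negative_type[of "[(x, 1), (y, 1), (u, -1), (v, -1)]"] assms(1-4) inv_q
    by (simp add: d_commute)
qed

lemma no_K3_3K1:
  assumes "adj u v" "adj u w" "adj v w"
    and "adj u x" "adj u y" "adj u z" "adj v x" "adj v y" "adj v z" "adj w x" "adj w y" "adj w z"
    and "x \<noteq> y" "x \<noteq> z" "y \<noteq> z" "\<not> adj x y" "\<not> adj x z" "\<not> adj y z"
  shows False
proof -
  have "adj x u" "adj y u" using assms(4,5) by (simp_all add: d_commute)
  then have "d x y = 2" "d x z = 2" "d y z = 2"
    using assms dist2I[of _ u] by blast+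
  then show False
    using negative_type[of "[(u, 1), (v, 1), (w, 1), (x, -1), (y, -1), (z, -1)]"] assms(1-12) inv_q
    by (simp add: d_commute)
qed

text \<open>In the next two lemmas the weights form a vector in the kernel of \<open>A + 2 I\<close>, where \<open>A\<close> is the
  adjacency matrix of the excluded subgraph.\<close>
lemma no_local_affine_D5:
  assumes "adj o' w" "adj o' x" "adj o' y" "adj o' z" "adj o' p" "adj o' r"
    and "adj w x" "adj w y" "adj w z" "adj x p" "adj x r"
    and "x \<noteq> y" "x \<noteq> z" "y \<noteq> z" "p \<noteq> r" "w \<noteq> p" "w \<noteq> r"
    and "\<not> adj x y" "\<not> adj x z" "\<not> adj y z" "\<not> adj w p" "\<not> adj w r" "\<not> adj p r"
      "\<not> adj y p" "\<not> adj y r" "\<not> adj z p" "\<not> adj z r"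
  shows False
proof -
  have ne: "y \<noteq> p" "y \<noteq> r" "z \<noteq> p" "z \<noteq> r" using assms by auto
  have o: "adj y o'" "adj x o'" "adj w o'" "adj z o'" "adj p o'" "adj r o'"
    using assms by (auto simp: d_commute)
  have "d x y = 2" "d x z = 2" "d y z = 2" "d p r = 2" "d w p = 2" "d w r = 2"
     "d y p = 2" "d y r = 2" "d z p = 2" "d z r = 2"
    using assms ne o dist2I[of _ o'] by blast+
  then show False
    using negative_type[of "[(w, 2), (x, -2), (y, -1), (z, -1), (p, 1), (r, 1)]"] assms(7-11) inv_q
    by (simp add: d_commute)
qed

lemma no_local_tailed_K4:
  assumes "adj o' w" "adj o' v" "adj o' x" "adj o' y" "adj o' z" "adj o' p"
    and "adj w v" "adj x y" "adj w x" "adj w y" "adj v x" "adj v y" "adj z w" "adj z v" "adj p x" "adj p y"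
    and "z \<noteq> p" "z \<noteq> x" "z \<noteq> y" "p \<noteq> w" "p \<noteq> v"
    and "\<not> adj z x" "\<not> adj z y" "\<not> adj p w" "\<not> adj p v" "\<not> adj z p"
  shows False
proof -
  have o: "adj z o'" "adj p o'" using assms by (auto simp: d_commute)
  have "d z p = 2" "d z x = 2" "d z y = 2" "d p w = 2" "d p v = 2"
    using assms o dist2I[of _ o'] by blast+
  then show False
    using negative_type[of "[(w, 1), (v, 1), (x, -1), (y, -1), (z, -1), (p, 1)]"] assms(7-16) inv_q
    by (simp add: d_commute)
qed

text \<open>For \<open>q < 1\<close> this excludes the icosahedron, with \<open>x, x'\<close> and \<open>y, y'\<close> antipodal pairs.\<close>
lemma no_antipodal_quadruple:
  assumes "adj x y" "adj x' y'" "d x y' \<le> 2" "d x' y \<le> 2"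
    and "d x x' \<ge> 3" "d y y' \<ge> 3"
  shows False
proof -
  have "q_length q (d x y') \<le> 1 + 1 / q" "q_length q (d x' y) \<le> 1 + 1 / q"
    "q_length q (d x x') \<ge> 1 + 1 / q + 1 / q ^ 2" "q_length q (d y y') \<ge> 1 + 1 / q + 1 / q ^ 2"
    using q_length_mono[OF q_pos] assms by (metis q_length_simps(3,4))+
  then show False
    using negative_type[of "[(x, 1), (x', 1), (y, -1), (y', -1)]"] assms(1,2) inv_q
    by (simp add: d_commute)
qed

definition common :: "'a \<Rightarrow> 'a \<Rightarrow> 'a set" where
  "common x y = {z. adj x z \<and> adj y z}"

lemma common_clique:
  assumes "d x y = 2" "u \<in> common x y" "v \<in> common x y" "u \<noteq> v"
  shows "adj u v"
proof -
  have "x \<noteq> y" using assms(1) by auto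
  then show ?thesis using quadrangle_chord[of x u y v] assms by (simp add: common_def d_commute)
qed

text \<open>Two nonadjacent neighbours of \<open>x\<close> have \<open>c\<close> common neighbours,
  one being \<open>x\<close>. The other \<open>c - 1\<close> are adjacent to \<open>x\<close> by
  \<open>common_clique\<close>, so they stay inside the neighbourhood. The relation includes
  adjacency to \<open>x\<close>, as a local graph has no edges outside its vertex set.\<close>

lemma local_graph_nbrs: "local_graph {y. adj x y} (\<lambda>y z. adj x y \<and> adj x z \<and> adj y z) a (c - 1)"
proof
  fix y assume y: "y \<in> {y. adj x y}"
  then show "card {z. adj x y \<and> adj x z \<and> adj y z} = a"
    using card_common_adj[of x y] by simp
  fix z assume z: "z \<in> {y. adj x y}" "y \<noteq> z" "\<not> (adj x y \<and> adj x z \<and> adj y z)"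
  have yz: "d y z = 2" using y z dist2I[of y x z] by (auto simp: d_commute)
  have x: "x \<in> common y z" using y z by (simp add: common_def d_commute)
  have adj_x: "adj x t" if "t \<in> common y z" "t \<noteq> x" for t
    using common_clique[OF yz x that(1)] that(2) by blast
  have "{t. (adj x y \<and> adj x t \<and> adj y t) \<and> adj x z \<and> adj x t \<and> adj z t} = common y z - {x}"
    using y z adj_x by (auto simp: common_def)
  then show "card {t. (adj x y \<and> adj x t \<and> adj y t) \<and> adj x z \<and> adj x t \<and> adj z t} = c - 1"
    using x card_common_dist2[OF yz] by (simp add: common_def)
next
  fix w p y1 y2 y3
  show False if "adj x w \<and> adj x p \<and> adj w p" "adj x w \<and> adj x y1 \<and> adj w y1"
    "adj x w \<and> adj x y2 \<and> adj w y2" "adj x w \<and> adj x y3 \<and> adj w y3" 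
    "adj x p \<and> adj x y1 \<and> adj p y1"
    "adj x p \<and> adj x y2 \<and> adj p y2" "adj x p \<and> adj x y3 \<and> adj p y3" 
    "y1 \<noteq> y2" "y1 \<noteq> y3" "y2 \<noteq> y3" "\<not> (adj x y1 \<and> adj x y2 \<and> adj y1 y2)"
     "\<not> (adj x y1 \<and> adj x y3 \<and> adj y1 y3)"  "\<not> (adj x y2 \<and> adj x y3 \<and> adj y2 y3)"
    using that by (intro no_K3_3K1[of x w p y1 y2 y3]) auto
next
  fix w y1 y2 y3 p p'
  show False if "adj x w \<and> adj x y1 \<and> adj w y1"
    "adj x w \<and> adj x y2 \<and> adj w y2" "adj x w \<and> adj x y3 \<and> adj w y3"
    "adj x y1 \<and> adj x p \<and> adj y1 p" "adj x y1 \<and> adj x p' \<and> adj y1 p'"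
    "y1 \<noteq> y2" "y1 \<noteq> y3" "y2 \<noteq> y3" "p \<noteq> p'" "w \<noteq> p" "w \<noteq> p'"
    "\<not> (adj x y1 \<and> adj x y2 \<and> adj y1 y2)"
     "\<not> (adj x y1 \<and> adj x y3 \<and> adj y1 y3)"  "\<not> (adj x y2 \<and> adj x y3 \<and> adj y2 y3)"
     "\<not> (adj x w \<and> adj x p \<and> adj w p)" "\<not> (adj x w \<and> adj x p' \<and> adj w p')"
     "\<not> (adj x p \<and> adj x p' \<and> adj p p')"
     "\<not> (adj x y2 \<and> adj x p \<and> adj y2 p)" "\<not> (adj x y2 \<and> adj x p' \<and> adj y2 p')"
     "\<not> (adj x y3 \<and> adj x p \<and> adj y3 p)" "\<not> (adj x y3 \<and> adj x p' \<and> adj y3 p')"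
    using that by (intro no_local_affine_D5[of x w y1 y2 y3 p p']) auto
next
  fix w v x' y z p
  show False if "adj x w \<and> adj x v \<and> adj w v" "adj x x' \<and> adj x y \<and> adj x' y"
    "adj x w \<and> adj x x' \<and> adj w x'" "adj x w \<and> adj x y \<and> adj w y"
    "adj x v \<and> adj x x' \<and> adj v x'" "adj x v \<and> adj x y \<and> adj v y"
    "adj x z \<and> adj x w \<and> adj z w" "adj x z \<and> adj x v \<and> adj z v"
    "adj x p \<and> adj x x' \<and> adj p x'" "adj x p \<and> adj x y \<and> adj p y"
    "z \<noteq> p" "z \<noteq> x'" "z \<noteq> y" "p \<noteq> w" "p \<noteq> v"
    "\<not> (adj x z \<and> adj x x' \<and> adj z x')" "\<not> (adj x z \<and> adj x y \<and> adj z y)"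
    "\<not> (adj x p \<and> adj x w \<and> adj p w)" "\<not> (adj x p \<and> adj x v \<and> adj p v)"
    "\<not> (adj x z \<and> adj x p \<and> adj z p)"
    using that by (intro no_local_tailed_K4[of x w v x' y z p]) auto
next
  fix y u z v
  show "adj x u \<and> adj x v \<and> adj u v"
    if "adj x y \<and> adj x u \<and> adj y u" "adj x u \<and> adj x z \<and> adj u z" "adj x z \<and> adj x v \<and> adj z v"
      "adj x v \<and> adj x y \<and> adj v y" "y \<noteq> z" "\<not> (adj x y \<and> adj x z \<and> adj y z)" "u \<noteq> v"
    using that quadrangle_chord[of y u z v] by auto
qed (use c_ge_2 in \<open>auto simp: d_commute\<close>)

section \<open>Wheels and the icosahedron\<close>

definition wheel :: "'a \<Rightarrow> 'a \<Rightarrow> 'a \<Rightarrow> 'a \<Rightarrow> 'a \<Rightarrow> 'a \<Rightarrow> bool" where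
  "wheel x v0 v1 v2 v3 v4 \<longleftrightarrow> {y. adj x y} = {v0, v1, v2, v3, v4} \<and> distinct [v0, v1, v2, v3, v4] \<and>
     adj v0 v1 \<and> adj v1 v2 \<and> adj v2 v3 \<and> adj v3 v4 \<and> adj v4 v0 \<and>
     \<not> adj v0 v2 \<and> \<not> adj v1 v3 \<and> \<not> adj v2 v4 \<and> \<not> adj v3 v0 \<and> \<not> adj v4 v1"

lemma wheel_rotate: "wheel x v0 v1 v2 v3 v4 \<Longrightarrow> wheel x v1 v2 v3 v4 v0"
  unfolding wheel_def by (auto simp: d_commute)

text \<open>Vertices at distance 2 are nonadjacent in the neighbourhood of any common neighbour
  \<open>x\<close>, so that neighbourhood is a pentagon.\<close>

lemma wheel_exists:
  assumes "d y z = 2"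
  obtains x v0 v1 v2 v3 v4 where "wheel x v0 v1 v2 v3 v4" "a = 2" "c = 2"
proof -
  have "card (common y z) > 0" using card_common_dist2[OF assms] c_ge_2 by (simp add: common_def)
  then obtain x where x: "adj y x" "adj z x" by (auto simp: card_gt_0_iff common_def)
  interpret L: local_graph "{y. adj x y}" "\<lambda>y z. adj x y \<and> adj x z \<and> adj y z" a "c - 1"
    by (rule local_graph_nbrs)
  have "y \<in> {y. adj x y}" "z \<in> {y. adj x y}" using x by (auto simp: d_commute)
  moreover have "y \<noteq> z" "\<not> (adj x y \<and> adj x z \<and> adj y z)" using assms by auto
  ultimately obtain v0 v1 v2 v3 v4 where P: "L.pentagon v0 v1 v2 v3 v4"
    and V: "{y. adj x y} = {v0, v1, v2, v3, v4}" and "a = 2" "c - 1 = 1"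
    by (rule L.local_pentagon)
  have "adj x v0" "adj x v1" "adj x v2" "adj x v3" "adj x v4" using V by auto
  then have "wheel x v0 v1 v2 v3 v4"
    using P V L.pentagon_distinct[OF P] unfolding wheel_def L.pentagon_def by auto
  then show ?thesis using that \<open>a = 2\<close> \<open>c - 1 = 1\<close> by simp
qed

lemma common_eq:
  assumes "u \<in> common x y" "v \<in> common x y" "u \<noteq> v" "adj x y \<or> d x y = 2" "a = 2" "c = 2"
  shows "common x y = {u, v}"
proof -
  have "card (common x y) = 2"
    using assms card_common_adj[of x y] card_common_dist2[of x y] by (auto simp: common_def)
  then show ?thesis using assms(1-3) by (intro card_subset_eq[symmetric]) auto
qed

text \<open>The rim edge \<open>v0 v1\<close> lies in two triangles. The apex of the one without
  \<open>x\<close> is not on the rim, because no rim vertex is adjacent to both ends.\<close>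

lemma wheel_tip:
  assumes W: "wheel x v0 v1 v2 v3 v4" and ac: "a = 2" "c = 2"
  obtains y where "d x y = 2" "common v0 v1 = {x, y}" "common x y = {v0, v1}"
proof -
  have D: "v0 \<noteq> v1" "v0 \<noteq> v3" using W by (auto simp: wheel_def)
  have A: "adj v0 v1" "\<not> adj v0 v2" "\<not> adj v3 v0" "\<not> adj v4 v1" "adj x v0" "adj x v1"
    using W by (auto simp: wheel_def)
  have x: "x \<in> common v0 v1" using A by (simp add: common_def d_commute)
  have "card (common v0 v1 - {x}) = 1" using x card_common_adj[OF A(1)] ac by (simp add: common_def)
  then obtain y where "common v0 v1 - {x} = {y}" by (rule card_1_singletonE)
  then have y: "common v0 v1 = {x, y}" "x \<noteq> y" using x by auto
  then have vy: "adj v0 y" "adj v1 y" by (auto simp: common_def)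
  have "\<not> adj x y"
  proof
    assume "adj x y"
    then have "y \<in> {v0, v1, v2, v3, v4}" using W by (auto simp: wheel_def)
    then show False using vy A by (auto simp: d_commute)
  qed
  then have xy: "d x y = 2" using dist2I[of x v0 y] A vy y by simp
  moreover have "common x y = {v0, v1}"
    using common_eq[of v0 x y v1] A vy D xy ac by (simp add: common_def d_commute)
  ultimately show ?thesis using that y by blast
qed

text \<open>For consecutive rim vertices \<open>u, v, w\<close>, the vertices \<open>y\<close> and
  \<open>w\<close> are at distance 2. Their second common neighbour is adjacent to \<open>v\<close>,
  so it is the other tip \<open>y'\<close> over \<open>v w\<close>.\<close>

lemma tips_adj:
  assumes "d x y = 2" "common u v = {x, y}" "common x y = {u, v}"
    and "common v w = {x, y'}" "adj v w" "u \<noteq> w" and ac: "a = 2" "c = 2"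
  shows "adj y y'"
proof -
  have v: "adj y v" "adj x v" and x: "adj x w" and yu: "adj u y"
    using assms by (auto simp: common_def d_commute)
  have "v \<noteq> w" using assms by auto
  then have "\<not> adj y w" using assms x by (auto simp: common_def)
  moreover have "y \<noteq> w" using x assms by auto
  ultimately have yw: "d y w = 2" using dist2I[of y v w] v assms by simp
  have "card (common y w) = 2" using card_common_dist2[OF yw] ac by (simp add: common_def)
  moreover have "v \<in> common y w" using v assms by (simp add: common_def d_commute)
  ultimately obtain t where t: "t \<in> common y w" "t \<noteq> v" by (auto simp: card_2_iff)
  then have "adj v t" using common_clique[OF yw _ t(1)] \<open>v \<in> common y w\<close> by blast
  then have "t \<in> {x, y'}" using t assms(4) by (auto simp: common_def)
  moreover have "t \<noteq> x" using t assms(1) by (auto simp: common_def d_commute)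
  ultimately show ?thesis using t by (auto simp: common_def)
qed

lemma dist2_common_nonempty: "d x y = 2 \<Longrightarrow> common x y \<noteq> {}"
  using card_common_dist2[of x y] c_ge_2 by (metis card.empty common_def not_numeral_le_zero)

text \<open>The vertices \<open>y0, \<dots>, y4\<close> and \<open>r\<close> found here complete the wheel to an icosahedron.\<close>
lemma no_wheel:
  assumes W: "wheel x v0 v1 v2 v3 v4" and ac: "a = 2" "c = 2"
  shows False
proof -
  note W1 = wheel_rotate[OF W]
  note W2 = wheel_rotate[OF W1]
  note W3 = wheel_rotate[OF W2]
  note W4 = wheel_rotate[OF W3]
  have D: "v0 \<noteq> v1" "v0 \<noteq> v2" "v0 \<noteq> v3" "v0 \<noteq> v4" "v1 \<noteq> v2" "v1 \<noteq> v3" "v1 \<noteq> v4"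
    "v2 \<noteq> v3" "v2 \<noteq> v4" "v3 \<noteq> v4" using W by (auto simp: wheel_def)
  have X: "{y. adj x y} = {v0, v1, v2, v3, v4}" using W by (simp add: wheel_def)
  have Xi: "adj x v0" "adj x v1" "adj x v2" "adj x v3" "adj x v4" using X by auto
  have A: "adj v0 v1" "adj v1 v2" "adj v2 v3" "adj v3 v4" "adj v4 v0" "\<not> adj v0 v2" "\<not> adj v1 v3"
     "\<not> adj v2 v4" "\<not> adj v3 v0" "\<not> adj v4 v1"
    using W by (auto simp: wheel_def)
  have A': "adj v1 v0" "adj v2 v1" "adj v3 v2" "adj v4 v3" "adj v0 v4" "\<not> adj v2 v0" "\<not> adj v3 v1"
     "\<not> adj v4 v2" "\<not> adj v0 v3" "\<not> adj v1 v4"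
    using A by (auto simp: d_commute)
  obtain y0 where y0: "d x y0 = 2" "common v0 v1 = {x, y0}" "common x y0 = {v0, v1}"
    using wheel_tip[OF W ac] .
  obtain y1 where y1: "d x y1 = 2" "common v1 v2 = {x, y1}" "common x y1 = {v1, v2}"
    using wheel_tip[OF W1 ac] .
  obtain y2 where y2: "d x y2 = 2" "common v2 v3 = {x, y2}" "common x y2 = {v2, v3}"
    using wheel_tip[OF W2 ac] .
  obtain y3 where y3: "d x y3 = 2" "common v3 v4 = {x, y3}" "common x y3 = {v3, v4}"
    using wheel_tip[OF W3 ac] .
  obtain y4 where y4: "d x y4 = 2" "common v4 v0 = {x, y4}" "common x y4 = {v4, v0}"
    using wheel_tip[OF W4 ac] .
  have Y: "adj y0 y1" "adj y1 y2" "adj y2 y3" "adj y3 y4" "adj y4 y0"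
    using tips_adj[OF y0 y1(2)] tips_adj[OF y1 y2(2)] tips_adj[OF y2 y3(2)] tips_adj[OF y3 y4(2)]
      tips_adj[OF y4 y0(2)] A D ac by auto
  have Y': "adj y1 y0" "adj y2 y1" "adj y3 y2" "adj y4 y3" "adj y0 y4"
    using Y by (auto simp: d_commute)
  have tip: "adj u y \<and> adj v y" if "common u v = {x, y}" for u v y
    using that by (auto simp: common_def)
  have VY: "adj v0 y0" "adj v1 y0" "adj v1 y1" "adj v2 y1" "adj v2 y2" "adj v3 y2"
    "adj v3 y3" "adj v4 y3" "adj v4 y4" "adj v0 y4"
    using tip[OF y0(2)] tip[OF y1(2)] tip[OF y2(2)] tip[OF y3(2)] tip[OF y4(2)] by blast+
  have YV: "adj y0 v0" "adj y0 v1" "adj y1 v1" "adj y1 v2" "adj y2 v2" "adj y2 v3"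
    "adj y3 v3" "adj y3 v4" "adj y4 v4" "adj y4 v0"
    using VY by (auto simp: d_commute)
  have off: "\<not> adj v y" if "common x y = {s, t}" "adj x v" "v \<noteq> s" "v \<noteq> t" for v y s t
    using that by (auto simp: common_def d_commute)
  have N: "\<not> adj v0 y1" "\<not> adj v4 y1" "\<not> adj v3 y1" "\<not> adj v4 y0" "\<not> adj v1 y4" "\<not> adj v2 y0"
     "\<not> adj v2 y3" "\<not> adj v1 y3" "\<not> adj v3 y4" "\<not> adj v2 y4" "\<not> adj v0 y3" "\<not> adj v4 y2"
    using off[OF y1(3) Xi(1)] off[OF y1(3) Xi(5)] off[OF y1(3) Xi(4)] off[OF y0(3) Xi(5)]
      off[OF y4(3) Xi(2)] off[OF y0(3) Xi(3)] off[OF y3(3) Xi(3)] off[OF y3(3) Xi(2)]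
      off[OF y4(3) Xi(4)] off[OF y4(3) Xi(3)] off[OF y3(3) Xi(1)] off[OF y2(3) Xi(5)]
      D by simp_all
  have yne: "y1 \<noteq> y4" "y1 \<noteq> y3" "y2 \<noteq> y4" "y0 \<noteq> y1" "y0 \<noteq> y4" "y3 \<noteq> y4"
    using VY N by auto
  have common_adj: "common u y = {s, t}" if "adj u y" "adj u s" "adj y s" "adj u t" "adj y t" "s \<noteq> t" for u y s t
    using that ac by (intro common_eq) (simp_all add: common_def)
  have ne: "y3 \<noteq> v0" "y2 \<noteq> v1" "y1 \<noteq> v0" "y4 \<noteq> v1" "y1 \<noteq> v3" "y3 \<noteq> v1" "y2 \<noteq> v4" "y4 \<noteq> v2"
    using A' A D VY N by auto
  \<comment> \<open>An edge here would close the quadrangle \<open>y1, y4, v0, v1\<close>, which has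
    no diagonal; the next two facts are similar.\<close>
  have y14: "\<not> adj y1 y4"
    using quadrangle_chord[of y1 y4 v0 v1] YV A A' VY N ne D by (auto simp: d_commute)
  have y13: "\<not> adj y1 y3"
    using quadrangle_chord[of y1 y3 v3 v2] YV A A' VY N ne D by (auto simp: d_commute)
  have y24: "\<not> adj y2 y4"
    using quadrangle_chord[of y2 y4 v4 v3] YV A A' VY N ne D by (auto simp: d_commute)
  have d14: "d y1 y4 = 2" using dist2I[of y1 y0 y4] Y Y' yne y14 by simp
  have "card (common y1 y4) = 2" using card_common_dist2[OF d14] ac by (simp add: common_def)
  moreover have y0c: "y0 \<in> common y1 y4" using Y Y' by (simp add: common_def)
  \<comment> \<open>\<open>r\<close> is the vertex antipodal to \<open>x\<close> in the
    icosahedron.\<close>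
  ultimately obtain r where r: "r \<in> common y1 y4" "r \<noteq> y0" by (auto simp: card_2_iff)
  have R: "adj y1 r" "adj y4 r" "adj y0 r"
    using r common_clique[OF d14 y0c r(1)] by (auto simp: common_def)
  have R': "adj r y1" "adj r y4" "adj r y0" using R by (auto simp: d_commute)
  have rne: "r \<noteq> v0" "r \<noteq> v1" "r \<noteq> v2" "r \<noteq> v4" "r \<noteq> y2" "r \<noteq> y3" "r \<noteq> x" "r \<noteq> y1" "r \<noteq> y4"
    using R R' N y14 y13 y24 y0 by (auto simp: d_commute)
  \<comment> \<open>Both triangles on each of these edges are known. As \<open>r\<close> is adjacent
    to one end of each, it cannot be adjacent to the other.\<close>
  have C: "common v0 y0 = {v1, y4}" "common v1 y0 = {v0, y1}" "common v4 y4 = {v0, y3}"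
    "common v2 y1 = {v1, y2}"
    using common_adj[OF VY(1) A(1) YV(2) VY(10) Y'(5)] common_adj[OF VY(2) A'(1) YV(1) VY(3) Y(1)]
      common_adj[OF VY(9) A(5) YV(10) VY(8) Y'(4)] common_adj[OF VY(4) A'(2) YV(3) VY(5) Y(2)] ne
    by auto
  have rv: "\<not> adj v0 r" "\<not> adj v1 r" "\<not> adj v4 r" "\<not> adj v2 r"
    using C R rne by (auto simp: common_def)
  have xr: "\<not> adj x r"
  proof
    assume "adj x r"
    then have "r \<in> {v0, v1}" using y0(3) R by (auto simp: common_def)
    then show False using rne by auto
  qed
  \<comment> \<open>Only \<open>v3\<close> could still be a common neighbour, but
    \<open>c = 2\<close> are required.\<close>
  have "d x r \<noteq> 2"
  proof
    assume xr2: "d x r = 2"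
    have "common x r \<subseteq> {v3}"
    proof
      fix t assume "t \<in> common x r"
      then have "t \<in> {y. adj x y}" "adj t r" by (auto simp: common_def d_commute)
      then show "t \<in> {v3}" unfolding X using rv by auto
    qed
    then have "card (common x r) \<le> 1" using card_mono[of "{v3}" "common x r"] by simp
    then show False using card_common_dist2[OF xr2] ac by (simp add: common_def)
  qed
  moreover have "d x r \<noteq> 0" using rne by simp
  ultimately have xr3: "d x r \<ge> 3" using xr by linarith
  \<comment> \<open>The valency is 5, so all neighbours of \<open>v4\<close> are known and none is
    adjacent to \<open>y1\<close>. This gives the second antipodal pair.\<close>
  have "card {y. adj v4 y} = card {y. adj x y}" by (simp only: valency)
  also have "\<dots> = 5" using X D by simp
  finally have card5: "card {y. adj v4 y} = 5" .
  have "distinct [x, v0, v3, y3, y4]" using Xi D y3 y4 yne VY N A by auto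
  then have "card {x, v0, v3, y3, y4} = 5" by simp
  then have V4: "{x, v0, v3, y3, y4} = {y. adj v4 y}"
    using card5 A A' VY Xi by (intro card_subset_eq) (auto simp: d_commute)
  have "d v4 y1 \<noteq> 2"
  proof
    assume "d v4 y1 = 2"
    then obtain t where t: "adj v4 t" "adj y1 t"
      using dist2_common_nonempty[of v4 y1] by (auto simp: common_def)
    then have "t \<in> {x, v0, v3, y3, y4}" using V4 by auto
    then show False using t y1(1) N y14 y13 by (auto simp: d_commute)
  qed
  moreover have "d v4 y1 \<noteq> 0" using A YV by auto
  ultimately have v43: "d v4 y1 \<ge> 3" using N(2) by linarith
  have "d r v4 \<le> 2" using d_triangle[of r v4 y4] R' YV by simp
  then show False
    using no_antipodal_quadruple[of x v4 r y1] xr3 v43 Xi R' y1(1) by simp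
qed

lemma no_dist2: "d x y \<noteq> 2"
  using wheel_exists no_wheel by blast

end

section \<open>Graph distances and weighted quadratic forms\<close>

lemma graph_dist_le: "pre_digraph.awalk (with_proj G) x p y \<Longrightarrow> graph_dist G x y \<le> length p"
  unfolding graph_dist_def by (intro wellorder_Inf_le1) auto

locale connected_pair_graph = pair_graph G for G :: "'a pair_pre_digraph" +
  assumes connected: "Digraph_Component.connected (with_proj G)"
    and verts_UNIV: "pverts G = UNIV"
begin

abbreviation d :: "'a \<Rightarrow> 'a \<Rightarrow> nat" where
  "d \<equiv> graph_dist G"

lemma shortest_walk: obtains p where "awalk x p y" "length p = d x y"
proof -
  have "strongly_connected (with_proj G)"
    using symmetric_connected_imp_strongly_connected[OF sym_arcs connected] .
  then have "x \<rightarrow>\<^sup>*\<^bsub>with_proj G\<^esub> y" using verts_UNIV by (auto simp: strongly_connected_def)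
  then have "{length p | p. awalk x p y} \<noteq> {}" by (auto simp: reachable_awalk)
  then have "d x y \<in> {length p | p. awalk x p y}"
    unfolding graph_dist_def by (rule Inf_nat_def1)
  then show ?thesis using that by auto
qed

lemma d_eq_0: "d x y = 0 \<longleftrightarrow> x = y"
proof
  assume "d x y = 0"
  then obtain p where "awalk x p y" "length p = 0" using shortest_walk[of x y] by metis
  then show "x = y" by (simp add: awalk_Nil_iff)
next
  assume "x = y"
  then show "d x y = 0" using graph_dist_le[of G x "[]" y] verts_UNIV by (simp add: awalk_Nil_iff)
qed

lemma length_rev_path: "length (rev_path p) = length p"
  by (induct p) auto

lemma d_commute: "d x y = d y x"
proof -
  have "d y x \<le> d x y" for x y
  proof -
    obtain p where p: "awalk x p y" "length p = d x y" by (rule shortest_walk)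
    then have "awalk y (rev_path p) x" by simp
    from graph_dist_le[OF this] show ?thesis using p by (simp add: length_rev_path)
  qed
  then show ?thesis by (simp add: le_antisym)
qed

lemma d_triangle: "d x z \<le> d x y + d y z"
proof -
  obtain p where p: "awalk x p y" "length p = d x y" by (rule shortest_walk)
  obtain r where r: "awalk y r z" "length r = d y z" by (rule shortest_walk)
  have "awalk x (p @ r) z" using p r by (auto intro: awalk_appendI)
  from graph_dist_le[OF this] show ?thesis using p r by simp
qed

lemma d_split:
  assumes "d x y = i + j"
  obtains z where "d x z = i" "d z y = j"
proof -
  obtain p where p: "awalk x p y" "length p = d x y" by (rule shortest_walk)
  then have "awalk x (take i p @ drop i p) y" by simp
  then obtain z where z: "awalk x (take i p) z" "awalk z (drop i p) y"
    using awalk_append_iff by blast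
  have "d x z \<le> i" "d z y \<le> j"
    using graph_dist_le[OF z(1)] graph_dist_le[OF z(2)] p assms by auto
  then have "d x z = i" "d z y = j" using d_triangle[of x y z] assms by linarith+
  then show ?thesis by (rule that)
qed

end

section \<open>Row sums and quadratic forms of weight vectors\<close>

text \<open>Group the summands by level. With distances from two vertices as \<open>f\<close> and
  \<open>f'\<close>, this makes all row sums of the matrix equal.\<close>

lemma sum_eq_if_level_sizes_eq:
  fixes f f' :: "'a::finite \<Rightarrow> nat" and g :: "nat \<Rightarrow> real"
  assumes "\<And>h. card {y. f y = h} = card {y. f' y = h}"
  shows "(\<Sum>y\<in>UNIV. g (f y)) = (\<Sum>y\<in>UNIV. g (f' y))"
proof -
  have "(\<Sum>y\<in>UNIV. g (F y)) = (\<Sum>h\<in>range f \<union> range f'. real (card {y. F y = h}) * g h)"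
    if "range F \<subseteq> range f \<union> range f'" for F :: "'a \<Rightarrow> nat"
  proof -
    have "(\<Sum>y\<in>UNIV. g (F y)) = (\<Sum>h\<in>range f \<union> range f'. \<Sum>y | y \<in> UNIV \<and> F y = h. g (F y))"
      using that by (intro sum.group[symmetric]) auto
    also have "\<dots> = (\<Sum>h\<in>range f \<union> range f'. real (card {y. F y = h}) * g h)"
      by (intro sum.cong) auto
    finally show ?thesis .
  qed
  then show ?thesis using assms by simp
qed

definition weight_vec :: "('n::finite \<times> real) list \<Rightarrow> real^'n" where
  "weight_vec ps = (\<Sum>(x, s)\<leftarrow>ps. s *\<^sub>R axis x 1)"

lemma weight_vec_inner: "weight_vec ps \<bullet> w = (\<Sum>(x, s)\<leftarrow>ps. s * w $ x)"
  by (induct ps) (auto simp: weight_vec_def inner_add_left inner_axis')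

lemma weight_vec_quadratic_form:
  "weight_vec ps \<bullet> (M *v weight_vec rs) = (\<Sum>(x, s)\<leftarrow>ps. \<Sum>(y, t)\<leftarrow>rs. s * t * M $ x $ y)"
proof -
  have "(M *v weight_vec rs) $ x = (\<Sum>(y, t)\<leftarrow>rs. t * M $ x $ y)" for x
    by (simp add: matrix_vector_mul_component inner_commute[of "M $ x"] weight_vec_inner)
  then show ?thesis
    by (simp add: weight_vec_inner sum_list_const_mult[symmetric] case_prod_unfold mult.assoc)
qed

theorem theorem5p4:
  fixes G :: "'a::finite pair_pre_digraph" and q :: real
  assumes "pverts G = UNIV"
    and "distance_regular G"
    and "graph_diameter G \<ge> 2"
    and "-1 < q" and "q < 1" and "q \<noteq> 0"
    and "num_pos_eigenvalues (q_distance_matrix G q) = 1"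
  shows "c2 G = 1 \<and> 0 < q \<and> q < 1"
proof -
  interpret connected_pair_graph G
    using assms(1,2) by (simp add: distance_regular_def connected_pair_graph_def connected_pair_graph_axioms_def)
  define M where "M = q_distance_matrix G q"
  have dxx [simp]: "d u u = 0" for u by (simp add: d_eq_0)
  have M: "M $ x $ y = q_length q (d x y)" for x y
    by (simp add: M_def q_distance_matrix_def q_length_def)
  have sym: "transpose M = M" by (simp add: transpose_def vec_eq_iff M d_commute)
  note no_plane = one_pos_eigenvalue_no_pos_plane[OF sym assms(7)[folded M_def]]
  have dr: "card {z. d x z = i \<and> d y z = j} = card {z. d x' z = i \<and> d y' z = j}"
    if "d x y = d x' y'" for x y x' y' i j
  proof -
    note all = assms(2)[unfolded distance_regular_def, THEN conjunct2, THEN conjunct2]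
    show ?thesis
      using all[rule_format, of x y x' y' "d x y" i j] that by (simp add: sphere_inter_def verts_UNIV)
  qed
  have "{d x y | x y. x \<in> pverts G \<and> y \<in> pverts G} = range (\<lambda>(x, y). d x y)"
    by (auto simp: verts_UNIV)
  then have "graph_diameter G \<in> range (\<lambda>(x, y). d x y)"
    unfolding graph_diameter_def using Max_in[of "range (\<lambda>(x, y). d x y)"] by simp
  then obtain x y' where "d x y' \<ge> 2" using assms(3) by auto
  then have "d x y' = 2 + (d x y' - 2)" by simp
  then obtain y where xy: "d x y = 2" by (rule d_split)
  then have "d x y = 1 + 1" by simp
  then obtain z where z: "d x z = 1" "d z y = 1" by (rule d_split)
  have "q > 0"
  proof (rule ccontr)
    assume "\<not> q > 0"
    then have s: "1 + 1 / q < 0" using assms(4,6) by (simp add: field_simps)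
    \<comment> \<open>Put \<open>s = 1 + 1/q\<close>. The coefficient \<open>-s\<close> at
      \<open>z\<close> makes \<open>M *v ?w\<close> vanish at \<open>x\<close> and \<open>y\<close>,
      so the two vectors are orthogonal for the form, and both have the positive value
      \<open>-2 s\<close>.\<close>
    let ?v = "weight_vec [(x, 1), (y, -1)]"
    let ?w = "weight_vec [(x, 1), (y, 1), (z, - (1 + 1 / q))]"
    have dd: "d y x = 2" "d z x = 1" "d y z = 1" using xy z by (simp_all add: d_commute)
    have "?v \<bullet> (M *v ?v) > 0" "?v \<bullet> (M *v ?w) = 0" "?w \<bullet> (M *v ?w) > 0"
      using s xy z dd by (simp_all add: weight_vec_quadratic_form M)
    then show False using no_plane by blast
  qed
  define r where "r = (\<Sum>t\<in>UNIV. q_length q (d x t))"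
  have row: "(M *v 1) $ u = r" for u
  proof -
    have "card {t. d u t = h} = card {t. d x t = h}" for h
      using dr[of u u x x h h] by simp
    from sum_eq_if_level_sizes_eq[OF this] show ?thesis
      by (simp add: r_def matrix_vector_mult_def M)
  qed
  have "r \<ge> q_length q (d x y)"
    unfolding r_def using \<open>q > 0\<close> by (intro member_le_sum) (auto simp: q_length_def sum_nonneg)
  then have "1 + 1 / q \<le> r" using xy by simp
  moreover have "1 / q > 0" using \<open>q > 0\<close> by simp
  ultimately have "r > 0" by linarith
  then have ones: "1 \<bullet> (M *v 1) > 0"
    by (simp add: inner_vec_def row)
  \<comment> \<open>Weights of sum 0 are orthogonal for the form to the all-ones vector, as the row
    sums are constant. A positive value would thus give a positive plane.\<close>
  have neg: "(\<Sum>(u, s)\<leftarrow>ps. \<Sum>(v, t)\<leftarrow>ps. s * t * q_length q (d u v)) \<le> 0"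
    if "sum_list (map snd ps) = 0" for ps
  proof (rule ccontr)
    assume "\<not> ?thesis"
    then have "weight_vec ps \<bullet> (M *v weight_vec ps) > 0"
      by (simp add: weight_vec_quadratic_form M)
    moreover have "1 \<bullet> (M *v weight_vec ps) = weight_vec ps \<bullet> (M *v 1)"
      using symmetric_inner_matrix_vector_mult[OF sym] by (simp add: inner_commute)
    moreover have "\<dots> = 0" using that
      by (simp add: weight_vec_inner row sum_list_mult_const case_prod_unfold)
    ultimately show False using no_plane[OF ones] by simp
  qed
  define c where "c = card {t. d x t = 1 \<and> d y t = 1}"
  have c: "card (sphere_inter G 1 1 u v) = c" if "d u v = 2" for u v
    using dr[of u v x y 1 1] that xy by (simp add: c_def sphere_inter_def verts_UNIV)
  have c2: "c2 G = c"
    unfolding c2_def intersection_number_def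
  \<comment> \<open>Uniqueness rests on the pair \<open>x, y\<close>, which shows that distance 2
    occurs.\<close>
  proof (rule the_equality)
    show "\<forall>u\<in>pverts G. \<forall>v\<in>pverts G. d u v = 2 \<longrightarrow> card (sphere_inter G 1 1 u v) = c"
      using c by blast
  next
    fix n
    assume "\<forall>u\<in>pverts G. \<forall>v\<in>pverts G. d u v = 2 \<longrightarrow> card (sphere_inter G 1 1 u v) = n"
    then show "n = c" using c[OF xy] xy verts_UNIV by blast
  qed
  have "z \<in> {t. d x t = 1 \<and> d y t = 1}" using z by (simp add: d_commute)
  then have "c \<noteq> 0" by (auto simp: c_def)
  moreover have "\<not> c \<ge> 2"
  proof
    assume c_ge_2: "c \<ge> 2"
    \<comment> \<open>The edge \<open>x z\<close> serves as reference for the number of triangles on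
      an edge.\<close>
    interpret N: negative_type_graph d q "card {t. d x t = 1}" "card {t. d x t = 1 \<and> d z t = 1}" c
    proof
      show "card {t. d u t = 1} = card {t. d x t = 1}" for u
        using dr[of u u x x 1 1] by simp
      show "card {t. d u t = 1 \<and> d v t = 1} = card {t. d x t = 1 \<and> d z t = 1}"
        if "d u v = 1" for u v using dr[of u v x z 1 1] that z by simp
      show "card {t. d u t = 1 \<and> d v t = 1} = c" if "d u v = 2" for u v
        using dr[of u v x y 1 1] that xy by (simp add: c_def)
    qed (fact d_eq_0 d_commute d_triangle \<open>q > 0\<close> assms(5) c_ge_2 neg)+
    show False using N.no_dist2 xy by blast
  qed
  ultimately show ?thesis using c2 \<open>q > 0\<close> assms(5) by linarith
qed

end
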